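(* Let $r,s\in\mathbb{C}^*$ be roots of unity with $r^2\neq s^2$. Let $\xi=(\xi_1,\xi_2)$ and $\xi'=(\xi_1',\xi_2')$ be elements of $\mathbb{C}^*\times\mathbb{C}$, and let $\ell_4$ be the integer attached to $\xi$. Then $\mathcal{M}(\xi)$ is isomorphic to $\mathcal{M}(\xi')$ as a $U^+_{r,s}(B_2)$-module if and only if $$\xi_1=(rs)^{-u}\xi_1',\quad \xi_2=\xi_2'$$ hold for some $u$ with $0\le u\le\ell_4-1$ such that $u$ is a multiple of $\operatorname{ord}(rs^{-1})$.
   Context: $U^+_{r,s}(B_2)$ is the unital associative $\mathbb{C}$-algebra generated by $e_1,e_2$ subject to $$e_1^2 e_2-(r^2+s^2)e_1e_2e_1+r^2s^2e_2e_1^2=0,$$ $$e_1e_2^3-(r^2+rs+s^2)e_2e_1e_2^2+rs(r^2+rs+s^2)e_2^2e_1e_2-r^3s^3e_2^3e_1=0.$$ Put $X_1=e_1$, $X_2=e_1e_2-r^2e_2e_1$, $X_3=e_2X_2-s^{-2}X_2e_2$, $X_4=e_2$. These satisfy $$X_1X_2=s^2X_2X_1,\quad X_1X_3=r^2s^2X_3X_1,\quad X_1X_4=r^2X_4X_1+X_2,$$ $$X_2X_3=rsX_3X_2,\quad X_2X_4=s^2X_4X_2-s^2X_3,\quad X_3X_4=rsX_4X_3,$$ and the monomials $X_1^aX_2^bX_3^cX_4^d$ form a basis. All modules are right modules; $\operatorname{ord}(z)$ is the multiplicative order of $z$. Put $\ell_4=\operatorname{lcm}(\operatorname{ord}(rs),\operatorname{ord}(rs^{-1}))$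 if $\xi_2\neq0$, $\ell_4=\operatorname{ord}(rs^{-1})$ if $\xi_2=0$. $\mathcal{M}(\xi)$ is the $U^+_{r,s}(B_2)$-module with basis $\{e(a):0\le a\le\ell_4-1\}$ and action $$e(a)X_1=\begin{cases}-r^{-2(a-1)}\frac{1-(rs^{-1})^{a-1}}{1-rs^{-1}}\frac{1-(rs^{-1})^a}{1-(rs^{-1})^2}\xi_1e(a-2),&a\neq0,1,\\0,&a=0,1,\end{cases}$$ $$e(a)X_2=\begin{cases}(rs)^{-(a-1)}\frac{1-(rs^{-1})^a}{1-rs^{-1}}\xi_1e(a-1),&a\neq0,\\0,&a=0,\end{cases}$$ $$e(a)X_3=(rs)^{-a}\xi_1e(a),\qquad e(a)X_4=\begin{cases}e(a+1),&a\neq\ell_4-1,\\ \xi_2e(0),&a=\ell_4-1.\end{cases}$$ *)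

theory Defs
  imports Complex_Main "HOL-Algebra.QuotRing" "HOL-Library.Poly_Mapping"
begin

section \<open>Right modules over a ring\<close>

text \<open>HOL-Algebra's \<^locale>\<open>module\<close> is about left modules over commutative rings. As there, the fields
  \<^const>\<open>mult\<close> and \<^const>\<open>one\<close> inherited from the ring record play no role.\<close>

record ('a, 'b) rmodule = "'b ring" +
  ract :: "['b, 'a] \<Rightarrow> 'b"

locale right_module = R?: ring R + M?: abelian_group M
  for R :: "('a, 'c) ring_scheme" (structure) and M :: "('a, 'b, 'd) rmodule_scheme" (structure) +
  assumes ract_closed: "\<lbrakk>x \<in> carrier M; a \<in> carrier R\<rbrakk> \<Longrightarrow> ract M x a \<in> carrier M"
    and ract_add_ring: "\<lbrakk>x \<in> carrier M; a \<in> carrier R; b \<in> carrier R\<rbrakk> \<Longrightarrow>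
      ract M x (a \<oplus>\<^bsub>R\<^esub> b) = ract M x a \<oplus>\<^bsub>M\<^esub> ract M x b"
    and ract_add_module: "\<lbrakk>x \<in> carrier M; y \<in> carrier M; a \<in> carrier R\<rbrakk> \<Longrightarrow>
      ract M (x \<oplus>\<^bsub>M\<^esub> y) a = ract M x a \<oplus>\<^bsub>M\<^esub> ract M y a"
    and ract_mult: "\<lbrakk>x \<in> carrier M; a \<in> carrier R; b \<in> carrier R\<rbrakk> \<Longrightarrow>
      ract M x (a \<otimes>\<^bsub>R\<^esub> b) = ract M (ract M x a) b"
    and ract_one: "x \<in> carrier M \<Longrightarrow> ract M x \<one>\<^bsub>R\<^esub> = x"

text \<open>When \<open>R\<close> is a unital \<open>\<complex>\<close>-algebra, \<open>\<complex>\<close>-linearity is part of \<open>R\<close>-linearity.\<close>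

definition rmodule_iso ::
    "('a, 'c) ring_scheme \<Rightarrow> ('a, 'b, 'd) rmodule_scheme \<Rightarrow> ('a, 'e, 'f) rmodule_scheme \<Rightarrow> ('b \<Rightarrow> 'e) set"
  where "rmodule_iso R M N = {h. bij_betw h (carrier M) (carrier N) \<and>
     (\<forall>x\<in>carrier M. \<forall>y\<in>carrier M. h (x \<oplus>\<^bsub>M\<^esub> y) = h x \<oplus>\<^bsub>N\<^esub> h y) \<and>
     (\<forall>x\<in>carrier M. \<forall>a\<in>carrier R. h (ract M x a) = ract N (h x) a)}"

definition rmodule_isomorphic ::
    "('a, 'c) ring_scheme \<Rightarrow> ('a, 'b, 'd) rmodule_scheme \<Rightarrow> ('a, 'e, 'f) rmodule_scheme \<Rightarrow> bool"
  where "rmodule_isomorphic R M N \<longleftrightarrow> rmodule_iso R M N \<noteq> {}"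


section \<open>The free algebra on two generators\<close>

datatype gen = E1 | E2

datatype word = Word "gen list"

text \<open>The free monoid, written additively so that \<open>word \<Rightarrow>\<^sub>0 complex\<close> with its convolution product is
  the free unital associative algebra.\<close>

instantiation word :: monoid_add
begin

definition zero_word :: word where "0 = Word []"

fun plus_word :: "word \<Rightarrow> word \<Rightarrow> word" where "Word u + Word v = Word (u @ v)"

instance
proof
  fix a b c :: word
  show "a + b + c = a + (b + c)" by (cases a; cases b; cases c) simp
  show "0 + a = a" "a + 0 = a" by (cases a; simp add: zero_word_def)+
qed

end

type_synonym free_alg = "word \<Rightarrow>\<^sub>0 complex"

definition free_ring :: "free_alg ring" where
  "free_ring = \<lparr>carrier = UNIV, mult = (*), one = 1, zero = 0, add = (+)\<rparr>"

definition scal :: "complex \<Rightarrow> free_alg" where "scal c = Poly_Mapping.single 0 c"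

definition e1 :: free_alg where "e1 = Poly_Mapping.single (Word [E1]) 1"
definition e2 :: free_alg where "e2 = Poly_Mapping.single (Word [E2]) 1"


section \<open>The algebra $U^+_{r,s}(B_2)$\<close>

definition serre1 :: "complex \<Rightarrow> complex \<Rightarrow> free_alg" where
  "serre1 r s = e1^2 * e2 - scal (r^2 + s^2) * e1 * e2 * e1 + scal (r^2 * s^2) * e2 * e1^2"

definition serre2 :: "complex \<Rightarrow> complex \<Rightarrow> free_alg" where
  "serre2 r s = e1 * e2^3 - scal (r^2 + r*s + s^2) * e2 * e1 * e2^2
     + scal (r*s * (r^2 + r*s + s^2)) * e2^2 * e1 * e2 - scal (r^3 * s^3) * e2^3 * e1"

definition U_ideal :: "complex \<Rightarrow> complex \<Rightarrow> free_alg set" where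
  "U_ideal r s = genideal free_ring {serre1 r s, serre2 r s}"

definition U_B2 :: "complex \<Rightarrow> complex \<Rightarrow> free_alg set ring" where
  "U_B2 r s = free_ring Quot U_ideal r s"

definition U_class :: "complex \<Rightarrow> complex \<Rightarrow> free_alg \<Rightarrow> free_alg set" where
  "U_class r s f = U_ideal r s +>\<^bsub>free_ring\<^esub> f"

text \<open>Representatives in the free algebra of $X_1, \dots, X_4$.\<close>

definition X1 :: free_alg where "X1 = e1"
definition X2 :: "complex \<Rightarrow> free_alg" where "X2 r = e1 * e2 - scal (r^2) * e2 * e1"
definition X3 :: "complex \<Rightarrow> complex \<Rightarrow> free_alg" where
  "X3 r s = e2 * X2 r - scal (s powi (-2)) * X2 r * e2"
definition X4 :: free_alg where "X4 = e2"


section \<open>The modules $\mathcal M(\xi)$\<close>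

definition root_of_unity :: "complex \<Rightarrow> bool" where
  "root_of_unity z \<longleftrightarrow> (\<exists>n>0. z ^ n = 1)"

text \<open>The multiplicative order, with the usual convention \<open>0\<close> for elements of infinite order.\<close>

definition mult_ord :: "complex \<Rightarrow> nat" where
  "mult_ord z = (if root_of_unity z then (LEAST n. 0 < n \<and> z ^ n = 1) else 0)"

definition ell4 :: "complex \<Rightarrow> complex \<Rightarrow> complex \<times> complex \<Rightarrow> nat" where
  "ell4 r s \<xi> = (if snd \<xi> \<noteq> 0 then lcm (mult_ord (r * s)) (mult_ord (r / s)) else mult_ord (r / s))"

text \<open>Vectors are coordinate functions; \<open>bas a\<close> is $e(a)$.\<close>

definition bas :: "nat \<Rightarrow> nat \<Rightarrow> complex" where
  "bas a = (\<lambda>b. if b = a then 1 else 0)"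

text \<open>The vectors $e(a)X_1, \dots, e(a)X_4$ as displayed in the definition of $\mathcal M(\xi)$.\<close>

definition basX1 :: "complex \<Rightarrow> complex \<Rightarrow> complex \<times> complex \<Rightarrow> nat \<Rightarrow> nat \<Rightarrow> complex" where
  "basX1 r s \<xi> a = (if a = 0 \<or> a = 1 then (\<lambda>_. 0) else
     (\<lambda>b. - (r powi (-2 * (int a - 1))) * ((1 - (r / s) ^ (a - 1)) / (1 - r / s))
        * ((1 - (r / s) ^ a) / (1 - (r / s)^2)) * fst \<xi> * bas (a - 2) b))"

definition basX2 :: "complex \<Rightarrow> complex \<Rightarrow> complex \<times> complex \<Rightarrow> nat \<Rightarrow> nat \<Rightarrow> complex" where
  "basX2 r s \<xi> a = (if a = 0 then (\<lambda>_. 0) else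
     (\<lambda>b. (r * s) powi (- (int a - 1)) * ((1 - (r / s) ^ a) / (1 - r / s)) * fst \<xi> * bas (a - 1) b))"

definition basX3 :: "complex \<Rightarrow> complex \<Rightarrow> complex \<times> complex \<Rightarrow> nat \<Rightarrow> nat \<Rightarrow> complex" where
  "basX3 r s \<xi> a = (\<lambda>b. (r * s) powi (- int a) * fst \<xi> * bas a b)"

definition basX4 :: "complex \<Rightarrow> complex \<Rightarrow> complex \<times> complex \<Rightarrow> nat \<Rightarrow> nat \<Rightarrow> complex" where
  "basX4 r s \<xi> a = (if a \<noteq> ell4 r s \<xi> - 1 then bas (a + 1) else (\<lambda>b. snd \<xi> * bas 0 b))"

definition lin_ext :: "nat \<Rightarrow> (nat \<Rightarrow> nat \<Rightarrow> complex) \<Rightarrow> (nat \<Rightarrow> complex) \<Rightarrow> nat \<Rightarrow> complex" where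
  "lin_ext l \<phi> v = (\<lambda>b. \<Sum>a<l. v a * \<phi> a b)"

text \<open>As $e_1 = X_1$ and $e_2 = X_4$ generate the algebra, the module structure is determined by these two.
  That it respects the relations, and that $X_2, X_3$ then act as displayed, is proved below
  (theorems \<open>Mxi_right_module\<close> and \<open>Mxi_actions\<close>).\<close>

definition gen_act :: "complex \<Rightarrow> complex \<Rightarrow> complex \<times> complex \<Rightarrow> gen \<Rightarrow> (nat \<Rightarrow> complex) \<Rightarrow> nat \<Rightarrow> complex" where
  "gen_act r s \<xi> g = lin_ext (ell4 r s \<xi>) (case g of E1 \<Rightarrow> basX1 r s \<xi> | E2 \<Rightarrow> basX4 r s \<xi>)"

text \<open>Right action of words: the leftmost letter acts first.\<close>

fun word_act :: "(gen \<Rightarrow> (nat \<Rightarrow> complex) \<Rightarrow> nat \<Rightarrow> complex) \<Rightarrow> word \<Rightarrow> (nat \<Rightarrow> complex) \<Rightarrow> nat \<Rightarrow> complex" where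
  "word_act op (Word w) v = fold op w v"

definition free_act :: "(gen \<Rightarrow> (nat \<Rightarrow> complex) \<Rightarrow> nat \<Rightarrow> complex) \<Rightarrow> free_alg \<Rightarrow> (nat \<Rightarrow> complex) \<Rightarrow> nat \<Rightarrow> complex" where
  "free_act op f v = (\<lambda>b. \<Sum>w\<in>Poly_Mapping.keys f. Poly_Mapping.lookup f w * word_act op w v b)"

definition Mxi :: "complex \<Rightarrow> complex \<Rightarrow> complex \<times> complex \<Rightarrow> (free_alg set, nat \<Rightarrow> complex) rmodule" where
  "Mxi r s \<xi> = \<lparr>carrier = {v. \<forall>a\<ge>ell4 r s \<xi>. v a = 0}, mult = undefined, one = undefined,
     zero = (\<lambda>_. 0), add = (\<lambda>v w b. v b + w b),
     ract = (\<lambda>v A. the_elem ((\<lambda>f. free_act (gen_act r s \<xi>) f v) ` A))\<rparr>"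


section \<open>Well-definedness\<close>

lemma free_ring: "ring free_ring"
proof (rule ringI)
  show "abelian_group free_ring"
  proof (rule abelian_groupI)
    fix x assume "x \<in> carrier free_ring"
    show "\<exists>y\<in>carrier free_ring. y \<oplus>\<^bsub>free_ring\<^esub> x = \<zero>\<^bsub>free_ring\<^esub>"
      by (rule bexI[of _ "-x"]) (simp_all add: free_ring_def)
  qed (auto simp: free_ring_def algebra_simps)
  show "Group.monoid free_ring"
    by (rule monoidI) (auto simp: free_ring_def algebra_simps)
qed (auto simp: free_ring_def algebra_simps)

lemma free_ring_simps [simp]:
  "carrier free_ring = UNIV" "x \<otimes>\<^bsub>free_ring\<^esub> y = x * y" "x \<oplus>\<^bsub>free_ring\<^esub> y = x + y"
  "\<one>\<^bsub>free_ring\<^esub> = 1" "\<zero>\<^bsub>free_ring\<^esub> = 0"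
  by (simp_all add: free_ring_def)

lemma U_ideal: "ideal (U_ideal r s) free_ring"
  unfolding U_ideal_def by (rule ring.genideal_ideal[OF free_ring]) simp

lemma U_B2_ring: "ring (U_B2 r s)"
  unfolding U_B2_def by (rule ideal.quotient_is_ring[OF U_ideal])

lemma word_act_plus: "word_act op (u + v) x = word_act op v (word_act op u x)"
  by (cases u; cases v) simp

lemma free_act_superset:
  assumes "finite S" "Poly_Mapping.keys f \<subseteq> S"
  shows "free_act op f v b = (\<Sum>w\<in>S. Poly_Mapping.lookup f w * word_act op w v b)"
  unfolding free_act_def
  by (rule sum.mono_neutral_left) (use assms in \<open>auto simp: in_keys_iff\<close>)

lemma free_act_add: "free_act op (f + g) v = (\<lambda>b. free_act op f v b + free_act op g v b)"
proof
  fix b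
  let ?S = "Poly_Mapping.keys f \<union> Poly_Mapping.keys g"
  have "Poly_Mapping.keys (f + g) \<subseteq> ?S" by (rule keys_add)
  then show "free_act op (f + g) v b = free_act op f v b + free_act op g v b"
    by (simp add: free_act_superset[of ?S] lookup_add distrib_right sum.distrib)
qed

lemma free_act_single: "free_act op (Poly_Mapping.single w c) v = (\<lambda>b. c * word_act op w v b)"
  by (rule ext) (subst free_act_superset[of "{w}"], auto)

lemma free_act_0: "free_act op 0 v = (\<lambda>_. 0)"
  by (simp add: free_act_def)

lemma free_act_uminus: "free_act op (- f) v = (\<lambda>b. - free_act op f v b)"
proof
  fix b
  have "free_act op (- f + f) v b = free_act op (- f) v b + free_act op f v b"
    by (simp only: free_act_add)
  then show "free_act op (- f) v b = - free_act op f v b"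
    by (simp add: free_act_0 eq_neg_iff_add_eq_0)
qed

lemma free_act_diff: "free_act op (f - g) v = (\<lambda>b. free_act op f v b - free_act op g v b)"
  using free_act_add[of op f "- g" v] by (simp add: free_act_uminus)

lemma free_alg_induct [case_names zero single add]:
  fixes f :: free_alg
  assumes "P 0" "\<And>w c. P (Poly_Mapping.single w c)" "\<And>f g. P f \<Longrightarrow> P g \<Longrightarrow> P (f + g)"
  shows "P f"
proof -
  have eq: "f = (\<Sum>w\<in>Poly_Mapping.keys f. Poly_Mapping.single w (Poly_Mapping.lookup f w))"
    by (rule poly_mapping_eqI)
       (auto simp: lookup_sum lookup_single when_def sum.delta in_keys_iff)
  have "P (\<Sum>w\<in>S. Poly_Mapping.single w (Poly_Mapping.lookup f w))" if "finite S" for S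
    using that by (induction S) (auto intro: assms)
  then show ?thesis by (subst eq) simp
qed

lemma lin_ext_add: "lin_ext l \<phi> (\<lambda>b. v b + w b) = (\<lambda>b. lin_ext l \<phi> v b + lin_ext l \<phi> w b)"
  by (simp add: lin_ext_def distrib_right sum.distrib)

lemma lin_ext_scale: "lin_ext l \<phi> (\<lambda>b. c * v b) = (\<lambda>b. c * lin_ext l \<phi> v b)"
  by (simp add: lin_ext_def sum_distrib_left mult.assoc)

lemma lin_ext_bas: "a < l \<Longrightarrow> lin_ext l \<phi> (bas a) = \<phi> a"
  by (rule ext) (simp add: lin_ext_def bas_def if_distrib[of "\<lambda>x. x * _"] cong: if_cong)

context
  fixes op :: "gen \<Rightarrow> (nat \<Rightarrow> complex) \<Rightarrow> nat \<Rightarrow> complex"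
  assumes op_add: "\<And>g v w. op g (\<lambda>b. v b + w b) = (\<lambda>b. op g v b + op g w b)"
    and op_scale: "\<And>g c v. op g (\<lambda>b. c * v b) = (\<lambda>b. c * op g v b)"
begin

lemma word_act_add: "word_act op w (\<lambda>b. u b + v b) = (\<lambda>b. word_act op w u b + word_act op w v b)"
proof (cases w)
  case (Word l)
  have "fold op l (\<lambda>b. u b + v b) = (\<lambda>b. fold op l u b + fold op l v b)"
    by (induction l arbitrary: u v) (simp_all add: op_add)
  with Word show ?thesis by simp
qed

lemma word_act_scale: "word_act op w (\<lambda>b. c * u b) = (\<lambda>b. c * word_act op w u b)"
proof (cases w)
  case (Word l)
  have "fold op l (\<lambda>b. c * u b) = (\<lambda>b. c * fold op l u b)"
    by (induction l arbitrary: u) (simp_all add: op_scale)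
  with Word show ?thesis by simp
qed

lemma free_act_add_vec: "free_act op f (\<lambda>b. u b + v b) = (\<lambda>b. free_act op f u b + free_act op f v b)"
  by (simp add: free_act_def word_act_add distrib_left sum.distrib)

lemma free_act_scale_vec: "free_act op f (\<lambda>b. c * u b) = (\<lambda>b. c * free_act op f u b)"
  by (simp add: free_act_def word_act_scale sum_distrib_left mult.left_commute)

lemma free_act_zero_vec: "free_act op f (\<lambda>_. 0) = (\<lambda>_. 0)"
  using free_act_scale_vec[of f 0 "\<lambda>_. 0"] by simp

lemma free_act_sum_vec:
  "finite I \<Longrightarrow> free_act op f (\<lambda>b. \<Sum>i\<in>I. v i b) = (\<lambda>b. \<Sum>i\<in>I. free_act op f (v i) b)"
  by (induction I rule: finite_induct) (simp_all add: free_act_zero_vec free_act_add_vec)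

lemma free_act_mult: "free_act op (f * g) v = free_act op g (free_act op f v)"
proof (induction f rule: free_alg_induct)
  case zero
  show ?case by (simp add: free_act_0 free_act_zero_vec)
next
  case (single w c)
  show ?case
  proof (induction g rule: free_alg_induct)
    case zero
    show ?case by (simp add: free_act_0)
  next
    case (single w' c')
    show ?case
      by (simp add: mult_single free_act_single word_act_plus word_act_scale mult.assoc mult.left_commute)
  next
    case (add f g)
    then show ?case by (simp add: free_act_add distrib_left)
  qed
next
  case (add f f')
  then show ?case by (simp add: free_act_add free_act_add_vec distrib_right)
qed

lemma free_act_scal: "free_act op (scal c) v = (\<lambda>b. c * v b)"
  by (simp add: scal_def free_act_single zero_word_def)

lemma free_act_one: "free_act op 1 v = v"
  using free_act_scal[of 1 v] by (simp add: scal_def)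

lemma free_act_e: "free_act op e1 v = op E1 v" "free_act op e2 v = op E2 v"
  by (simp_all add: e1_def e2_def free_act_single)

end

lemma serre1_eq: "serre1 r s = X1 * X2 r - scal (s^2) * X2 r * X1"
  unfolding serre1_def X1_def X2_def e1_def e2_def scal_def
  by (rule poly_mapping_eqI)
     (auto simp: algebra_simps power2_eq_square mult_single lookup_add lookup_minus lookup_single when_def zero_word_def)

lemma serre2_eq:
  assumes "s \<noteq> 0"
  shows "serre2 r s = scal (- (s^2)) * (X3 r s * X4 - scal (r * s) * X4 * X3 r s)"
  unfolding serre2_def X3_def X4_def X2_def e1_def e2_def scal_def
  by (rule poly_mapping_eqI)
     (use assms in \<open>auto simp: algebra_simps power2_eq_square power3_eq_cube power_int_minus mult_single
        lookup_add lookup_minus lookup_uminus lookup_single when_def zero_word_def field_simps\<close>)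

lemma mult_ord_power: "z ^ mult_ord z = 1"
proof (cases "root_of_unity z")
  case True
  then obtain n where "0 < n \<and> z ^ n = 1" by (auto simp: root_of_unity_def)
  then have "z ^ (LEAST n. 0 < n \<and> z ^ n = 1) = 1" by (rule LeastI2) simp
  with True show ?thesis by (simp add: mult_ord_def)
qed (simp add: mult_ord_def)

lemma mult_ord_pos: assumes "root_of_unity z" shows "0 < mult_ord z"
proof -
  from assms obtain n where "0 < n \<and> z ^ n = 1" by (auto simp: root_of_unity_def)
  then have "0 < (LEAST n. 0 < n \<and> z ^ n = 1)" by (rule LeastI2) simp
  with assms show ?thesis by (simp add: mult_ord_def)
qed

lemma root_of_unity_mult: "root_of_unity x \<Longrightarrow> root_of_unity y \<Longrightarrow> root_of_unity (x * y)"
  unfolding root_of_unity_def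
proof (elim exE conjE)
  fix m n :: nat assume "m > 0" "x ^ m = 1" "n > 0" "y ^ n = 1"
  then have "x ^ (m * n) = 1" "y ^ (n * m) = 1" by (simp_all add: power_mult)
  then have "(x * y) ^ (m * n) = 1" by (simp add: power_mult_distrib mult.commute)
  with \<open>m > 0\<close> \<open>n > 0\<close> show "\<exists>n>0. (x * y) ^ n = 1" by (intro exI[of _ "m * n"]) simp
qed

lemma root_of_unity_divide: "root_of_unity x \<Longrightarrow> root_of_unity y \<Longrightarrow> root_of_unity (x / y)"
  using root_of_unity_mult[of x "inverse y"]
  by (simp add: divide_inverse root_of_unity_def power_inverse)

context
  fixes r s :: complex and \<xi> :: "complex \<times> complex"
  assumes r: "root_of_unity r" and s: "root_of_unity s" and rs: "r^2 \<noteq> s^2"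
begin

abbreviation (input) "l \<equiv> ell4 r s \<xi>"
abbreviation (input) "q \<equiv> r / s"
abbreviation (input) "op \<equiv> gen_act r s \<xi>"

lemma r0: "r \<noteq> 0" and s0: "s \<noteq> 0"
  using r s by (auto simp: root_of_unity_def power_0_left split: if_splits)

lemma q2: "q^2 \<noteq> 1" and q1: "q \<noteq> 1"
  using rs s0 by (auto simp: power_divide)

lemma l_pos: "0 < l"
  using r s by (simp add: ell4_def mult_ord_pos root_of_unity_mult root_of_unity_divide lcm_pos_nat)

lemma q_l: "q ^ l = 1"
proof -
  have "mult_ord q dvd l" by (simp add: ell4_def)
  then obtain k where "l = mult_ord q * k" by (auto elim: dvdE)
  then show ?thesis by (simp add: power_mult mult_ord_power)
qed

lemma rs_l: assumes "snd \<xi> \<noteq> 0" shows "(r * s) ^ l = 1"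
proof -
  have "mult_ord (r * s) dvd l" using assms by (simp add: ell4_def)
  then obtain k where "l = mult_ord (r * s) * k" by (auto elim: dvdE)
  then have "(r * s) ^ l = ((r * s) ^ mult_ord (r * s)) ^ k" by (simp only: power_mult)
  then show ?thesis by (simp add: mult_ord_power)
qed

lemma op_add: "op g (\<lambda>b. v b + w b) = (\<lambda>b. op g v b + op g w b)"
  and op_scale: "op g (\<lambda>b. c * v b) = (\<lambda>b. c * op g v b)"
  by (simp_all add: gen_act_def lin_ext_add lin_ext_scale)

lemmas act_mult = free_act_mult[of op, OF op_add op_scale]
lemmas act_scale_vec = free_act_scale_vec[of op, OF op_add op_scale]
lemmas act_add_vec = free_act_add_vec[of op, OF op_add op_scale]
lemmas act_zero_vec = free_act_zero_vec[of op, OF op_add op_scale]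
lemmas act_sum_vec = free_act_sum_vec[of op, OF op_add op_scale]
lemmas act_scal = free_act_scal[of op, OF op_add op_scale]
lemmas act_one = free_act_one[of op, OF op_add op_scale]
lemmas act_e = free_act_e[of op, OF op_add op_scale]

definition "k1 a = - (r powi (-2 * (int a - 1))) * ((1 - q ^ (a - 1)) / (1 - q)) * ((1 - q ^ a) / (1 - q^2)) * fst \<xi>"
definition "k2 a = (r * s) powi (- (int a - 1)) * ((1 - q ^ a) / (1 - q)) * fst \<xi>"
definition "k3 a = (r * s) powi (- int a) * fst \<xi>"

lemma k_zero: "k1 0 = 0" "k1 (Suc 0) = 0" "k2 0 = 0" "k1 l = 0" "k2 l = 0"
  using q_l by (simp_all add: k1_def k2_def)

lemma k1_Suc: "k1 (Suc n) = - inverse (r ^ (2 * n)) * ((1 - q ^ n) / (1 - q)) * ((1 - q ^ Suc n) / (1 - q^2)) * fst \<xi>"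
proof -
  have "- 2 * (int (Suc n) - 1) = - int (2 * n)" by simp
  then have "r powi (- 2 * (int (Suc n) - 1)) = inverse (r ^ (2 * n))"
    by (simp only: power_int_minus power_int_of_nat)
  then show ?thesis unfolding k1_def by simp
qed

lemma k2_Suc: "k2 (Suc n) = inverse ((r * s) ^ n) * ((1 - q ^ Suc n) / (1 - q)) * fst \<xi>"
  by (simp add: k2_def power_int_minus)

lemma k3_nat: "k3 n = inverse ((r * s) ^ n) * fst \<xi>"
  by (simp add: k3_def power_int_minus)

lemma k2_rec: "k1 (Suc n) - r^2 * k1 (Suc (Suc n)) = k2 (Suc n)"
proof -
  have aux: "- R * ((1 - A) / (1 - Q)) * ((1 - Q * A) / (1 - Q^2)) * x
      - r^2 * (- (R / r^2) * ((1 - Q * A) / (1 - Q)) * ((1 - Q * (Q * A)) / (1 - Q^2)) * x)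
      = A * R * ((1 - Q * A) / (1 - Q)) * x"
    if Q: "1 - Q \<noteq> 0" "1 - Q^2 \<noteq> 0" for A R Q x :: complex
  proof -
    have "- R * ((1 - A) / (1 - Q)) * ((1 - Q * A) / (1 - Q^2)) * x
      - r^2 * (- (R / r^2) * ((1 - Q * A) / (1 - Q)) * ((1 - Q * (Q * A)) / (1 - Q^2)) * x)
      = R * ((1 - Q * A) / (1 - Q)) * x * (((1 - Q * (Q * A)) - (1 - A)) / (1 - Q^2))"
    proof -
      have "- R * (a / d) * (b / e) * x - r^2 * (- (R / r^2) * (b / d) * (c / e) * x)
        = R * (b / d) * x * ((c - a) / e)" for a b c d e
        using r0 by (simp add: diff_divide_distrib right_diff_distrib mult_ac)
      then show ?thesis .
    qed
    also have "(1 - Q * (Q * A)) - (1 - A) = A * (1 - Q^2)"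
      by (simp add: algebra_simps power2_eq_square)
    finally show ?thesis using Q(2) by (simp add: mult_ac)
  qed
  have d: "1 - q \<noteq> 0" "1 - q^2 \<noteq> 0" using q1 q2 by auto
  have "inverse ((r * s) ^ n) = q ^ n * inverse (r ^ (2 * n))"
    using r0 s0 by (simp add: power_divide power_mult_distrib power_mult power2_eq_square field_simps)
  moreover have "inverse (r ^ (2 * Suc n)) = inverse (r ^ (2 * n)) / r^2"
    by (simp add: power2_eq_square divide_inverse mult_ac)
  ultimately show ?thesis
    unfolding k1_Suc k2_Suc using aux[OF d, of "inverse (r ^ (2 * n))" "q ^ n" "fst \<xi>"] by simp
qed

lemma k3_rec: "k2 (Suc n) - s powi (-2) * k2 n = k3 n"
proof (cases n)
  case 0
  have "1 - q \<noteq> 0" using q1 by auto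
  then have "(1 - q) / (1 - q) = 1" by (rule divide_self)
  then have "k2 (Suc 0) = fst \<xi>" by (simp only: k2_Suc power_0 power_Suc0_right inverse_1 mult_1_left)
  with 0 show ?thesis by (simp add: k_zero k3_nat)
next
  case (Suc m)
  have d: "1 - q \<noteq> 0" using q1 by auto
  have k: "k2 n = (r * s) * inverse ((r * s) ^ n) * ((1 - q ^ n) / (1 - q)) * fst \<xi>"
  proof -
    have "inverse ((r * s) ^ m) = (r * s) * inverse ((r * s) ^ Suc m)"
      using r0 s0 by (simp add: field_simps)
    then show ?thesis unfolding Suc k2_Suc by simp
  qed
  have sq: "s powi (-2) * (r * s) = q"
    using s0 by (simp add: power_int_minus power2_eq_square field_simps)
  have eq: "s powi (-2) * k2 n = q * (inverse ((r * s) ^ n) * ((1 - q ^ n) / (1 - q)) * fst \<xi>)"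
    unfolding k sq[symmetric] by (simp only: mult.assoc)
  have aux: "I * ((1 - Q * A) / (1 - Q)) * x - Q * (I * ((1 - A) / (1 - Q)) * x) = I * x"
    if "1 - Q \<noteq> 0" for I A Q x :: complex
  proof -
    have "I * ((1 - Q * A) / (1 - Q)) * x - Q * (I * ((1 - A) / (1 - Q)) * x)
      = I * x * (((1 - Q * A) - Q * (1 - A)) / (1 - Q))"
    proof -
      have "I * (a / d) * x - Q * (I * (b / d) * x) = I * x * ((a - Q * b) / d)" for a b d
        by (simp add: diff_divide_distrib right_diff_distrib mult_ac)
      then show ?thesis .
    qed
    also have "(1 - Q * A) - Q * (1 - A) = 1 - Q" by (simp add: algebra_simps)
    finally show ?thesis using that by simp
  qed
  show ?thesis unfolding eq unfolding k2_Suc k3_nat power_Suc by (rule aux[OF d])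
qed

lemma k12_comm: "k1 (Suc (Suc (Suc n))) * k2 (Suc n) = s^2 * (k2 (Suc (Suc (Suc n))) * k1 (Suc (Suc n)))"
proof -
  have "inverse (r ^ (2 * Suc (Suc n))) * inverse ((r * s) ^ n) =
      s^2 * (inverse ((r * s) ^ Suc (Suc n)) * inverse (r ^ (2 * Suc n)))"
    using r0 s0 by (simp add: field_simps power2_eq_square)
  moreover have "- R1 * (a / d) * (b / e) * x * (R2 * (c / d) * x) =
      s^2 * (R3 * (b / d) * x * (- R4 * (c / d) * (a / e) * x))"
    if "R1 * R2 = s^2 * (R3 * R4)" for R1 R2 R3 R4 a b c d e x :: complex
  proof -
    have "- R1 * (a / d) * (b / e) * x * (R2 * (c / d) * x) = - (R1 * R2) * (a * b * c * x * x / (d * d * e))"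
      by (simp add: mult_ac)
    then show ?thesis unfolding that by (simp add: mult_ac)
  qed
  ultimately show ?thesis unfolding k1_Suc k2_Suc by blast
qed

lemma k3_comm: "k3 n = r * s * k3 (Suc n)"
  using r0 s0 by (simp add: k3_nat field_simps)

lemma op_zero: "op g (\<lambda>_. 0) = (\<lambda>_. 0)"
  using op_scale[of g 0 "\<lambda>_. 0"] by simp

lemma act_X1: "a < l \<Longrightarrow> free_act op X1 (bas a) = basX1 r s \<xi> a"
  by (simp add: X1_def act_e gen_act_def lin_ext_bas)

lemma act_X4: "a < l \<Longrightarrow> free_act op X4 (bas a) = basX4 r s \<xi> a"
  by (simp add: X4_def act_e gen_act_def lin_ext_bas)

lemma basX1: "basX1 r s \<xi> a = (\<lambda>b. k1 a * bas (a - 2) b)"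
  by (auto simp: basX1_def k1_def)

lemma basX2: "basX2 r s \<xi> a = (\<lambda>b. k2 a * bas (a - 1) b)"
  by (auto simp: basX2_def k2_def)

lemma basX3: "basX3 r s \<xi> a = (\<lambda>b. k3 a * bas a b)"
  by (simp add: basX3_def k3_def)

lemma op1: "a < l \<Longrightarrow> op E1 (bas a) = (\<lambda>b. k1 a * bas (a - 2) b)"
  by (simp add: gen_act_def lin_ext_bas basX1)

lemma op2: "Suc a < l \<Longrightarrow> op E2 (bas a) = bas (Suc a)"
  by (auto simp: gen_act_def lin_ext_bas basX4_def)

lemma op2_last: assumes "Suc a = l" shows "op E2 (bas a) = (\<lambda>b. snd \<xi> * bas 0 b)"
proof -
  from assms have "a < l" "a = l - 1" by linarith+
  then have "op E2 (bas a) = basX4 r s \<xi> a" by (simp add: gen_act_def lin_ext_bas del: One_nat_def)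
  also have "\<dots> = (\<lambda>b. snd \<xi> * bas 0 b)"
    using \<open>a = l - 1\<close> by (simp only: basX4_def simp_thms if_False)
  finally show ?thesis .
qed

lemma op21: assumes "a < l" shows "op E1 (op E2 (bas a)) = (\<lambda>b. k1 (Suc a) * bas (a - 1) b)"
proof (cases "Suc a = l")
  case True
  then show ?thesis using l_pos by (simp add: op2_last op_scale op1 k_zero)
next
  case False
  with assms show ?thesis by (simp add: op2 op1)
qed

lemma act_X2: assumes "a < l" shows "free_act op (X2 r) (bas a) = basX2 r s \<xi> a"
proof -
  have "free_act op (X2 r) (bas a) = (\<lambda>b. op E2 (op E1 (bas a)) b - r^2 * op E1 (op E2 (bas a)) b)"
    by (simp add: X2_def free_act_diff act_mult act_e act_scal op_scale)
  also have "\<dots> = (\<lambda>b. k2 a * bas (a - 1) b)"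
  proof (cases a)
    case 0
    then show ?thesis using l_pos assms
      by (simp add: op21) (simp add: op1 op_zero k_zero k1_Suc)
  next
    case (Suc n)
    have "(\<lambda>b. k1 a * op E2 (bas (a - 2)) b) = (\<lambda>b. k1 a * bas (a - 1) b)"
    proof (cases n)
      case 0
      then show ?thesis by (simp add: Suc k_zero)
    next
      case (Suc m)
      with \<open>a = Suc n\<close> assms show ?thesis by (simp add: op2)
    qed
    then have "(\<lambda>b. op E2 (op E1 (bas a)) b - r^2 * op E1 (op E2 (bas a)) b)
      = (\<lambda>b. (k1 (Suc n) - r^2 * k1 (Suc (Suc n))) * bas n b)"
      using assms by (simp add: op21 op1 op_scale Suc fun_eq_iff left_diff_distrib)
    then show ?thesis by (simp add: k2_rec Suc)
  qed
  finally show ?thesis by (simp add: basX2)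
qed

lemma act_X3: assumes "a < l" shows "free_act op (X3 r s) (bas a) = basX3 r s \<xi> a"
proof -
  have "free_act op (X3 r s) (bas a) =
     (\<lambda>b. free_act op (X2 r) (op E2 (bas a)) b - s powi (-2) * op E2 (free_act op (X2 r) (bas a)) b)"
    by (simp only: X3_def free_act_diff act_mult act_e act_scal op_scale act_scale_vec)
  moreover have "free_act op (X2 r) (op E2 (bas a)) = (\<lambda>b. k2 (Suc a) * bas a b)"
  proof (cases "Suc a = l")
    case True
    then show ?thesis using l_pos
      by (simp add: op2_last act_scale_vec act_X2 basX2 k_zero)
  next
    case False
    with assms show ?thesis by (simp add: op2 act_X2 basX2)
  qed
  moreover have "op E2 (free_act op (X2 r) (bas a)) = (\<lambda>b. k2 a * bas a b)"
  proof (cases a)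
    case 0
    then show ?thesis using assms by (simp add: act_X2 basX2 op_zero k_zero)
  next
    case (Suc n)
    then show ?thesis using assms by (simp add: act_X2 basX2 op_scale op2)
  qed
  ultimately show ?thesis
    by (simp add: basX3 fun_eq_iff flip: k3_rec) (simp add: algebra_simps)
qed

lemma act_serre1: assumes "a < l" shows "free_act op (serre1 r s) (bas a) = (\<lambda>_. 0)"
proof -
  have "free_act op (serre1 r s) (bas a) =
    (\<lambda>b. k1 a * free_act op (X2 r) (bas (a - 2)) b - s^2 * (k2 a * free_act op X1 (bas (a - 1)) b))"
    using assms by (simp add: serre1_eq free_act_diff act_mult act_scal act_scale_vec act_X1 act_X2 basX1 basX2)
  also have "\<dots> = (\<lambda>b. (k1 a * k2 (a - 2) - s^2 * (k2 a * k1 (a - 1))) * bas (a - 3) b)"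
    using assms by (simp add: act_X1 act_X2 basX1 basX2 fun_eq_iff left_diff_distrib numeral_3_eq_3 mult.assoc)
  also have "k1 a * k2 (a - 2) - s^2 * (k2 a * k1 (a - 1)) = 0"
  proof -
    consider "a = 0" | "a = 1" | "a = 2" | n where "a = Suc (Suc (Suc n))"
      by (metis One_nat_def Suc_1 not0_implies_Suc)
    then show ?thesis by cases (simp_all add: k_zero k12_comm)
  qed
  finally show ?thesis by simp
qed

lemma act_serre2: assumes "a < l" shows "free_act op (serre2 r s) (bas a) = (\<lambda>_. 0)"
proof -
  have "free_act op (X3 r s * X4 - scal (r * s) * X4 * X3 r s) (bas a) =
    (\<lambda>b. k3 a * free_act op X4 (bas a) b - r * s * free_act op (X3 r s) (free_act op X4 (bas a)) b)"
    using assms by (simp add: free_act_diff act_mult act_scal act_scale_vec act_X3 basX3)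
  also have "\<dots> = (\<lambda>_. 0)"
  proof (cases "Suc a = l")
    case l: True
    have "snd \<xi> = 0 \<or> k3 a = r * s * k3 0"
    proof (cases "snd \<xi> = 0")
      case False
      from rs_l[OF this] have "k3 (Suc a) = k3 0" by (simp add: k3_nat l)
      then show ?thesis using k3_comm[of a] by simp
    qed simp
    moreover have "free_act op X4 (bas a) = (\<lambda>b. snd \<xi> * bas 0 b)"
      using l by (simp add: X4_def act_e op2_last)
    ultimately show ?thesis using l_pos by (auto simp: act_scale_vec act_X3 basX3)
  next
    case False
    with assms have "free_act op X4 (bas a) = bas (Suc a)" "Suc a < l"
      by (simp_all add: X4_def act_e op2)
    then show ?thesis by (simp add: act_X3 basX3 k3_comm[of a])
  qed
  finally show ?thesis
    by (simp only: serre2_eq[OF s0] act_mult[of "scal _"] act_scal act_scale_vec mult_zero_right)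
qed

lemma carrier_expand:
  assumes "v \<in> carrier (Mxi r s \<xi>)"
  shows "v = (\<lambda>b. \<Sum>a<l. v a * bas a b)"
  using assms by (auto simp: Mxi_def bas_def if_distrib[of "\<lambda>x. _ * x"] fun_eq_iff cong: if_cong)

lemma free_act_closed:
  assumes "v \<in> carrier (Mxi r s \<xi>)"
  shows "free_act op f v \<in> carrier (Mxi r s \<xi>)"
proof -
  define C where "C = carrier (Mxi r s \<xi>)"
  have bC: "basX1 r s \<xi> a \<in> C" "basX4 r s \<xi> a \<in> C" if "a < l" for a
    using that l_pos by (auto simp: C_def Mxi_def basX1 basX4_def bas_def)
  have lin_C: "lin_ext l \<phi> v \<in> C" if "\<And>a. a < l \<Longrightarrow> \<phi> a \<in> C" for \<phi> v
    using that by (auto simp: C_def Mxi_def lin_ext_def intro!: sum.neutral)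
  have op_C: "op g v \<in> C" for g v
    unfolding gen_act_def by (rule lin_C) (auto simp: bC split: gen.splits)
  have word_C: "word_act op w v \<in> C" if "v \<in> C" for w v
  proof (cases w)
    case (Word x)
    have "fold op x v \<in> C" using that by (induction x arbitrary: v) (simp_all add: op_C)
    with Word show ?thesis by simp
  qed
  show ?thesis
    using word_C[OF assms[folded C_def]] by (auto simp: C_def Mxi_def free_act_def intro!: sum.neutral)
qed

lemma act_kills:
  assumes "f \<in> U_ideal r s" "v \<in> carrier (Mxi r s \<xi>)"
  shows "free_act op f v = (\<lambda>_. 0)"
proof -
  define C where "C = carrier (Mxi r s \<xi>)"
  define K where "K = {f. \<forall>v\<in>C. free_act op f v = (\<lambda>_. 0)}"
  have act_C: "free_act op f v \<in> C" if "v \<in> C" for f v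
    using free_act_closed that by (simp add: C_def)
  interpret ring free_ring by (rule free_ring)
  have "ideal K free_ring"
  proof (rule idealI[OF free_ring])
    show "subgroup K (add_monoid free_ring)"
    proof (rule group.subgroupI)
      show "Group.group (add_monoid free_ring)" by (rule a_group)
      show "K \<noteq> {}" by (auto simp: K_def intro!: exI[of _ 0] free_act_0)
      fix a assume a: "a \<in> K"
      have "inv\<^bsub>add_monoid free_ring\<^esub> a = - a"
        by (rule group.inv_equality[OF a_group]) simp_all
      then show "inv\<^bsub>add_monoid free_ring\<^esub> a \<in> K" using a by (simp add: K_def free_act_uminus)
      fix b assume "b \<in> K"
      then show "a \<otimes>\<^bsub>add_monoid free_ring\<^esub> b \<in> K" using a by (simp add: K_def free_act_add)
    qed simp
  qed (auto simp: K_def act_mult act_zero_vec act_C)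
  moreover have "free_act op f v = (\<lambda>_. 0)" if "v \<in> C" "\<And>a. a < l \<Longrightarrow> free_act op f (bas a) = (\<lambda>_. 0)" for f v
    by (subst carrier_expand[OF that(1)[unfolded C_def]])
       (simp add: act_sum_vec act_scale_vec that(2))
  then have "{serre1 r s, serre2 r s} \<subseteq> K"
    by (auto simp: K_def act_serre1 act_serre2)
  ultimately have "U_ideal r s \<subseteq> K"
    unfolding U_ideal_def by (rule genideal_minimal)
  with assms show ?thesis by (auto simp: K_def C_def)
qed

lemma Mxi_ract:
  assumes "v \<in> carrier (Mxi r s \<xi>)"
  shows "ract (Mxi r s \<xi>) v (U_class r s f) = free_act op f v"
proof -
  have "free_act op g v = free_act op f v" if "g \<in> U_class r s f" for g
  proof -
    from that obtain h where "h \<in> U_ideal r s" "g = h + f"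
      by (auto simp: U_class_def a_r_coset_def r_coset_def)
    then show ?thesis by (simp only: free_act_add act_kills[OF _ assms] add_0_left)
  qed
  moreover have "f \<in> U_class r s f"
  proof -
    interpret ideal "U_ideal r s" free_ring by (rule U_ideal)
    show ?thesis unfolding U_class_def by (rule a_rcos_self) simp
  qed
  ultimately have "(\<lambda>f. free_act op f v) ` U_class r s f = {free_act op f v}" by blast
  then show ?thesis by (simp only: Mxi_def rmodule.simps the_elem_eq)
qed

theorem Mxi_actions:
  assumes "a < l"
  shows "ract (Mxi r s \<xi>) (bas a) (U_class r s X1) = basX1 r s \<xi> a"
    and "ract (Mxi r s \<xi>) (bas a) (U_class r s (X2 r)) = basX2 r s \<xi> a"
    and "ract (Mxi r s \<xi>) (bas a) (U_class r s (X3 r s)) = basX3 r s \<xi> a"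
    and "ract (Mxi r s \<xi>) (bas a) (U_class r s X4) = basX4 r s \<xi> a"
    and "ract (Mxi r s \<xi>) (bas a) (U_class r s (scal c)) = (\<lambda>b. c * bas a b)"
proof -
  have "bas a \<in> carrier (Mxi r s \<xi>)" using assms by (auto simp: Mxi_def bas_def)
  then show "ract (Mxi r s \<xi>) (bas a) (U_class r s X1) = basX1 r s \<xi> a"
    "ract (Mxi r s \<xi>) (bas a) (U_class r s (X2 r)) = basX2 r s \<xi> a"
    "ract (Mxi r s \<xi>) (bas a) (U_class r s (X3 r s)) = basX3 r s \<xi> a"
    "ract (Mxi r s \<xi>) (bas a) (U_class r s X4) = basX4 r s \<xi> a"
    "ract (Mxi r s \<xi>) (bas a) (U_class r s (scal c)) = (\<lambda>b. c * bas a b)"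
    using assms by (simp_all add: Mxi_ract act_X1 act_X2 act_X3 act_X4 act_scal)
qed

lemma U_carrierE:
  assumes "A \<in> carrier (U_B2 r s)"
  obtains f where "A = U_class r s f"
  using assms by (auto simp: U_B2_def FactRing_def A_RCOSETS_def RCOSETS_def U_class_def a_r_coset_def)

lemma U_class_carrier: "U_class r s f \<in> carrier (U_B2 r s)"
  using ring_hom_closed[OF ideal.rcos_ring_hom[OF U_ideal]] by (simp add: U_B2_def U_class_def)

lemma U_class_hom:
  "U_class r s f \<oplus>\<^bsub>U_B2 r s\<^esub> U_class r s g = U_class r s (f + g)"
  "U_class r s f \<otimes>\<^bsub>U_B2 r s\<^esub> U_class r s g = U_class r s (f * g)"
  "\<one>\<^bsub>U_B2 r s\<^esub> = U_class r s 1"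
  using ring_hom_add[OF ideal.rcos_ring_hom[OF U_ideal[of r s]], of f g]
    ring_hom_mult[OF ideal.rcos_ring_hom[OF U_ideal[of r s]], of f g]
    ring_hom_one[OF ideal.rcos_ring_hom[OF U_ideal[of r s]]]
  by (simp_all add: U_B2_def U_class_def)

lemma Mxi_abelian_group: "abelian_group (Mxi r s \<xi>)"
proof (rule abelian_groupI)
  fix x assume "x \<in> carrier (Mxi r s \<xi>)"
  then show "\<exists>y\<in>carrier (Mxi r s \<xi>). y \<oplus>\<^bsub>Mxi r s \<xi>\<^esub> x = \<zero>\<^bsub>Mxi r s \<xi>\<^esub>"
    by (intro bexI[of _ "\<lambda>b. - x b"]) (simp_all add: Mxi_def)
qed (auto simp: Mxi_def add_ac)

theorem Mxi_right_module: "right_module (U_B2 r s) (Mxi r s \<xi>)"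
proof (intro right_module.intro right_module_axioms.intro U_B2_ring Mxi_abelian_group)
  fix x A assume x: "x \<in> carrier (Mxi r s \<xi>)" and "A \<in> carrier (U_B2 r s)"
  then obtain f where f: "A = U_class r s f" by (auto elim: U_carrierE)
  with x show "ract (Mxi r s \<xi>) x A \<in> carrier (Mxi r s \<xi>)"
    by (simp add: Mxi_ract free_act_closed)
  {
    fix y assume y: "y \<in> carrier (Mxi r s \<xi>)"
    have "x \<oplus>\<^bsub>Mxi r s \<xi>\<^esub> y = (\<lambda>b. x b + y b)" by (simp add: Mxi_def)
    moreover have "(\<lambda>b. x b + y b) \<in> carrier (Mxi r s \<xi>)" using x y by (auto simp: Mxi_def)
    ultimately show "ract (Mxi r s \<xi>) (x \<oplus>\<^bsub>Mxi r s \<xi>\<^esub> y) A =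
        ract (Mxi r s \<xi>) x A \<oplus>\<^bsub>Mxi r s \<xi>\<^esub> ract (Mxi r s \<xi>) y A"
      using x y by (simp add: f Mxi_ract act_add_vec) (simp add: Mxi_def)
  }
  fix B assume "B \<in> carrier (U_B2 r s)"
  then obtain g where g: "B = U_class r s g" by (auto elim: U_carrierE)
  show "ract (Mxi r s \<xi>) x (A \<oplus>\<^bsub>U_B2 r s\<^esub> B) = ract (Mxi r s \<xi>) x A \<oplus>\<^bsub>Mxi r s \<xi>\<^esub> ract (Mxi r s \<xi>) x B"
    using x by (simp add: f g U_class_hom Mxi_ract free_act_add) (simp add: Mxi_def)
  show "ract (Mxi r s \<xi>) x (A \<otimes>\<^bsub>U_B2 r s\<^esub> B) = ract (Mxi r s \<xi>) (ract (Mxi r s \<xi>) x A) B"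
    using x by (simp add: f g U_class_hom Mxi_ract free_act_closed act_mult)
next
  fix x assume "x \<in> carrier (Mxi r s \<xi>)"
  then show "ract (Mxi r s \<xi>) x \<one>\<^bsub>U_B2 r s\<^esub> = x"
    by (simp add: U_class_hom Mxi_ract act_one)
qed

end

hide_const (open) l q op k1 k2 k3

end

theory Submission
  imports Defs
begin

text \<open>
  Any isomorphism sends \<open>e(0)\<close> to a nonzero vector that is killed by \<open>X\<^sub>2\<close> and is an eigenvector of
  \<open>X\<^sub>3\<close> with eigenvalue \<open>\<xi>\<^sub>1\<close>. Both operators send basis vectors to multiples of basis vectors, so each
  nonzero coordinate \<open>u\<close> of the image satisfies \<open>(r/s)\<^sup>u = 1\<close> and \<open>\<xi>\<^sub>1 = (rs)\<^sup>-\<^sup>u \<xi>\<^sub>1'\<close>. Moreover the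
  \<open>\<ell>\<^sub>4\<close>-th power of \<open>X\<^sub>4\<close> is the scalar \<open>\<xi>\<^sub>2\<close>, which forces \<open>\<xi>\<^sub>2 = \<xi>\<^sub>2'\<close>. Conversely, when
  \<open>\<xi>\<^sub>2 = \<xi>\<^sub>2'\<close> the operator \<open>X\<^sub>4\<close> is the same on both modules, and its \<open>u\<close>-th power is an isomorphism.
\<close>

section \<open>Orders of roots of unity\<close>

lemma mult_ord_dvd:
  assumes "root_of_unity z" "z ^ n = 1"
  shows "mult_ord z dvd n"
proof (rule ccontr)
  assume "\<not> mult_ord z dvd n"
  then have pos: "0 < n mod mult_ord z" by (simp add: dvd_eq_mod_eq_0)
  have "z ^ n = z ^ (mult_ord z * (n div mult_ord z) + n mod mult_ord z)" by simp
  also have "\<dots> = z ^ (n mod mult_ord z)"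
    by (simp only: power_add power_mult mult_ord_power power_one mult_1_left)
  finally have "z ^ (n mod mult_ord z) = 1" using assms(2) by simp
  with pos have "(LEAST n. 0 < n \<and> z ^ n = 1) \<le> n mod mult_ord z" by (intro Least_le) simp
  moreover have "n mod mult_ord z < mult_ord z" using mult_ord_pos[OF assms(1)] by simp
  ultimately show False using assms(1) by (simp add: mult_ord_def)
qed

lemma power_mult_ord_dvd: "mult_ord z dvd n \<Longrightarrow> z ^ n = 1"
  by (auto simp: power_mult mult_ord_power elim!: dvdE)

text \<open>A word acts by composing generator actions, so commutation passes from letters to words
  by induction on the word, and to their combinations by linearity. The set \<open>C\<close> will be
  a module carrier, where commutation with the generators can be checked on basis vectors.\<close>

lemma free_act_intertwine:
  assumes h_add: "\<And>v w. h (\<lambda>b. v b + w b) = (\<lambda>b. h v b + h w b)"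
    and h_scale: "\<And>c v. h (\<lambda>b. c * v b) = (\<lambda>b. c * h v b)"
    and op_C: "\<And>g v. v \<in> C \<Longrightarrow> op g v \<in> C"
    and h_op: "\<And>g v. v \<in> C \<Longrightarrow> h (op g v) = op' g (h v)"
    and v: "v \<in> C"
  shows "h (free_act op f v) = free_act op' f (h v)"
proof (induction f rule: free_alg_induct)
  case zero
  show ?case using h_scale[of 0 "\<lambda>_. 0"] by (simp add: free_act_0)
next
  case (single w c)
  have "h (fold op l v) = fold op' l (h v)" for l
    using v by (induction l arbitrary: v) (simp_all add: op_C h_op)
  then show ?case by (cases w) (simp add: free_act_single h_scale)
next
  case (add f g)
  then show ?case by (simp add: free_act_add h_add)
qed

section \<open>Powers of \<open>X4\<close> on a single module\<close>

context
  fixes r s :: complex and \<xi> :: "complex \<times> complex"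
  assumes r: "root_of_unity r" and s: "root_of_unity s" and rs: "r^2 \<noteq> s^2"
begin

abbreviation (input) "L \<equiv> ell4 r s \<xi>"
abbreviation (input) "T \<equiv> gen_act r s \<xi> E2"
abbreviation (input) "M \<equiv> Mxi r s \<xi>"

lemma gen_act_closed: "v \<in> carrier M \<Longrightarrow> gen_act r s \<xi> g v \<in> carrier M"
  using free_act_closed[OF r s rs, of v \<xi> e1] free_act_closed[OF r s rs, of v \<xi> e2]
  by (cases g) (simp_all add: act_e[OF r s rs])

lemma funpow_X4_add: "(T ^^ n) (\<lambda>b. v b + w b) = (\<lambda>b. (T ^^ n) v b + (T ^^ n) w b)"
  by (induction n) (simp_all add: op_add[OF r s rs])

lemma funpow_X4_scale: "(T ^^ n) (\<lambda>b. c * v b) = (\<lambda>b. c * (T ^^ n) v b)"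
  by (induction n) (simp_all add: op_scale[OF r s rs])

lemma funpow_X4_closed: "v \<in> carrier M \<Longrightarrow> (T ^^ n) v \<in> carrier M"
  by (induction n) (simp_all add: gen_act_closed)

text \<open>Realises iterates of \<open>T\<close> by an algebra element, so that module isomorphisms
  respect them.\<close>

lemma free_act_X4_power: "free_act (gen_act r s \<xi>) (X4 ^ n) v = (T ^^ n) v"
  by (induction n arbitrary: v)
     (simp_all add: act_one[OF r s rs] act_mult[OF r s rs] act_e[OF r s rs] X4_def funpow_swap1)

lemma bas_carrier: "a < L \<Longrightarrow> bas a \<in> carrier M"
  by (auto simp: Mxi_def bas_def)

lemma linear_eqI:
  fixes F G :: "(nat \<Rightarrow> complex) \<Rightarrow> nat \<Rightarrow> complex"
  assumes "\<And>v w. F (\<lambda>b. v b + w b) = (\<lambda>b. F v b + F w b)" "\<And>c v. F (\<lambda>b. c * v b) = (\<lambda>b. c * F v b)"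
    and "\<And>v w. G (\<lambda>b. v b + w b) = (\<lambda>b. G v b + G w b)" "\<And>c v. G (\<lambda>b. c * v b) = (\<lambda>b. c * G v b)"
    and bas: "\<And>a. a < L \<Longrightarrow> F (bas a) = G (bas a)"
    and v: "v \<in> carrier M"
  shows "F v = G v"
proof -
  have "F (\<lambda>b. \<Sum>a<n. v a * bas a b) = G (\<lambda>b. \<Sum>a<n. v a * bas a b)" if "n \<le> L" for n
    using that
  proof (induction n)
    case 0
    show ?case using assms(2)[of 0 "\<lambda>_. 0"] assms(4)[of 0 "\<lambda>_. 0"] by simp
  next
    case (Suc n)
    then show ?case by (simp add: assms(1-4) bas)
  qed
  from this[of L] show ?thesis
    using carrier_expand[OF r s rs v] by simp
qed

lemma funpow_X4_bas: "a < L \<Longrightarrow> (T ^^ a) (bas 0) = bas a"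
  by (induction a) (simp_all add: op2[OF r s rs])

text \<open>\<open>T\<close> runs through the basis and returns to \<open>bas 0\<close> with the
  factor \<open>snd \<xi>\<close>. Each \<open>bas a\<close> is a power of \<open>T\<close> applied
  to \<open>bas 0\<close>, and powers of \<open>T\<close> commute, so the same factor appears at
  every \<open>a\<close>.\<close>

lemma funpow_X4_ell4:
  assumes "v \<in> carrier M"
  shows "(T ^^ L) v = (\<lambda>b. snd \<xi> * v b)"
proof (rule linear_eqI[OF _ _ _ _ _ assms])
  fix a assume a: "a < L"
  obtain k where k: "L = Suc k" using l_pos[OF r s rs] by (metis gr0_implies_Suc)
  have "(T ^^ L) (bas 0) = T (bas k)"
    using funpow_X4_bas[of k] by (simp add: k)
  also have "\<dots> = (\<lambda>b. snd \<xi> * bas 0 b)" using op2_last[OF r s rs, of k \<xi>] k by simp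
  finally have "(T ^^ a) ((T ^^ L) (bas 0)) = (\<lambda>b. snd \<xi> * bas a b)"
    by (simp add: funpow_X4_scale funpow_X4_bas[OF a])
  moreover have "(T ^^ L) ((T ^^ a) (bas 0)) = (T ^^ a) ((T ^^ L) (bas 0))"
    by (metis funpow_add add.commute comp_apply)
  ultimately show "(T ^^ L) (bas a) = (\<lambda>b. snd \<xi> * bas a b)"
    by (simp add: funpow_X4_bas[OF a])
qed (simp_all add: funpow_X4_add funpow_X4_scale algebra_simps)

lemma funpow_X4_ell4_mult:
  assumes "v \<in> carrier M"
  shows "(T ^^ (L * n)) v = (\<lambda>b. snd \<xi> ^ n * v b)"
proof (induction n)
  case (Suc n)
  have "(T ^^ (L * Suc n)) v = (T ^^ L) ((T ^^ (L * n)) v)"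
    by (simp only: mult_Suc_right funpow_add comp_apply)
  also have "\<dots> = (\<lambda>b. snd \<xi> ^ Suc n * v b)"
    unfolding Suc funpow_X4_scale funpow_X4_ell4[OF assms] by (simp add: mult_ac)
  finally show ?case .
qed simp

section \<open>The action of \<open>X1\<close> along the \<open>X4\<close>-orbit of
  \<open>bas 0\<close>\<close>

text \<open>The factors built from powers of \<open>r / s\<close> have period \<open>n\<close>.
  Since \<open>r ^ n = s ^ n\<close>, the remaining factor changes by the inverse of
  \<open>r ^ (2 * n) = (r * s) ^ n\<close>.\<close>

lemma k1_shift:
  assumes "(r / s) ^ n = 1"
  shows "Defs.k1 r s \<xi> (n + a) = inverse ((r * s) ^ n) * Defs.k1 r s \<xi> a"
proof (cases a)
  \<comment> \<open>\<open>k1_Suc\<close> covers successor indices only; for \<open>a = 0\<close>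
    both sides vanish.\<close>
  case 0
  show ?thesis
  proof (cases n)
    case (Suc m)
    then show ?thesis using 0 assms by (simp add: k1_Suc[OF r s rs] k_zero[OF r s rs])
  qed (simp add: 0)
next
  case (Suc m)
  have r0: "r \<noteq> 0" and s0: "s \<noteq> 0" using r0[OF r s rs] s0[OF r s rs] .
  have "r ^ n = s ^ n" using assms s0 by (simp add: power_divide)
  then have r2: "r ^ (2 * n) = (r * s) ^ n" by (simp add: power_mult_distrib mult_2 power_add)
  have A: "(r / s) ^ (n + k) = (r / s) ^ k" for k using assms by (simp add: power_add)
  have B: "inverse (r ^ (2 * (n + m))) = inverse ((r * s) ^ n) * inverse (r ^ (2 * m))"
    by (simp add: r2[symmetric] power_add distrib_left)
  show ?thesis
    unfolding Suc add_Suc_right k1_Suc[OF r s rs] B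
    unfolding add_Suc_right[symmetric] A by (simp only: mult_minus_left mult_minus_right mult.assoc)
qed

text \<open>For \<open>N \<le> 1\<close> the truncated \<open>N - 2\<close> is harmless because the coefficient vanishes.\<close>

lemma X1_funpow_X4:
  assumes "N < L \<or> snd \<xi> \<noteq> 0"
  shows "gen_act r s \<xi> E1 ((T ^^ N) (bas 0)) = (\<lambda>b. Defs.k1 r s \<xi> N * (T ^^ (N - 2)) (bas 0) b)"
  using assms
proof (induction N rule: less_induct)
  case (less N)
  have l0: "0 < L" by (rule l_pos[OF r s rs])
  show ?case
  proof (cases "N < L")
    case True
    then show ?thesis by (simp add: funpow_X4_bas op1[OF r s rs])
  next
    case False
    then obtain K where N: "N = L + K" by (metis le_Suc_ex not_less)
    from False less.prems have nz: "snd \<xi> \<noteq> 0" by simp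
    have step: "(T ^^ (L + j)) (bas 0) = (\<lambda>b. snd \<xi> * (T ^^ j) (bas 0) b)" for j
      using funpow_X4_ell4[OF funpow_X4_closed[OF bas_carrier[OF l0]]]
      by (simp add: funpow_add)
    \<comment> \<open>For nonzero \<open>snd \<xi>\<close>, \<open>L\<close> is also a multiple of
      the order of \<open>r * s\<close>, so the shift factor is 1.\<close>
    have per: "Defs.k1 r s \<xi> N = Defs.k1 r s \<xi> K"
      unfolding N using k1_shift[OF q_l[OF r s rs]] rs_l[OF r s rs nz] by simp
    have IH: "gen_act r s \<xi> E1 ((T ^^ K) (bas 0)) = (\<lambda>b. Defs.k1 r s \<xi> K * (T ^^ (K - 2)) (bas 0) b)"
      using less.IH[of K] nz l0 N by simp
    show ?thesis
    \<comment> \<open>For \<open>K < 2\<close> truncation makes \<open>L + (K - 2)\<close> differ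
      from \<open>N - 2\<close>, so the zero coefficient is what saves the equation.\<close>
    proof (cases "K < 2")
      case True
      then have "Defs.k1 r s \<xi> K = 0" by (auto simp: less_2_cases_iff k_zero[OF r s rs])
      then show ?thesis
        by (simp only: per[unfolded N] IH N step op_scale[OF r s rs]) simp
    next
      case False
      then have "N - 2 = L + (K - 2)" by (simp add: N)
      then show ?thesis
        by (simp only: per[unfolded N] IH N step op_scale[OF r s rs] mult.left_commute)
    qed
  qed
qed

end

section \<open>What an isomorphism preserves\<close>

lemma rmodule_iso_free_act:
  assumes r: "root_of_unity r" and s: "root_of_unity s" and rs: "r^2 \<noteq> s^2"
    and h: "h \<in> rmodule_iso (U_B2 r s) (Mxi r s \<xi>) (Mxi r s \<xi>')"
    and v: "v \<in> carrier (Mxi r s \<xi>)"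
  shows "h (free_act (gen_act r s \<xi>) f v) = free_act (gen_act r s \<xi>') f (h v)"
proof -
  have "h v \<in> carrier (Mxi r s \<xi>')" using h v by (auto simp: rmodule_iso_def bij_betw_def)
  moreover have "h (ract (Mxi r s \<xi>) v (U_class r s f)) = ract (Mxi r s \<xi>') (h v) (U_class r s f)"
    using h v U_class_carrier[OF r s rs] by (auto simp: rmodule_iso_def)
  ultimately show ?thesis using v by (simp add: Mxi_ract[OF r s rs])
qed

text \<open>A priori the two cycle lengths may differ, so the scalars by which powers of
  \<open>X4\<close> act are compared at common multiples of both lengths.\<close>

lemma rmodule_iso_snd_eq:
  assumes r: "root_of_unity r" and s: "root_of_unity s" and rs: "r^2 \<noteq> s^2"
    and h: "h \<in> rmodule_iso (U_B2 r s) (Mxi r s \<xi>) (Mxi r s \<xi>')"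
  shows "snd \<xi> = snd \<xi>'"
proof -
  let ?l = "ell4 r s \<xi>" and ?l' = "ell4 r s \<xi>'" and ?T' = "gen_act r s \<xi>' E2"
  have pos: "0 < ?l" "0 < ?l'" by (rule l_pos[OF r s rs])+
  have e0: "bas 0 \<in> carrier (Mxi r s \<xi>')" by (rule bas_carrier[OF r s rs pos(2)])
  have "h ` carrier (Mxi r s \<xi>) = carrier (Mxi r s \<xi>')"
    using h by (simp add: rmodule_iso_def bij_betw_def)
  with e0 obtain v where v: "v \<in> carrier (Mxi r s \<xi>)" "h v = bas 0"
    by (metis imageE)
  have pow: "(?T' ^^ (?l * n)) (bas 0) = (\<lambda>b. snd \<xi> ^ n * bas 0 b)" for n
  proof -
    have "h (free_act (gen_act r s \<xi>) (X4 ^ (?l * n)) v) = (?T' ^^ (?l * n)) (bas 0)"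
      using rmodule_iso_free_act[OF r s rs h v(1), of "X4 ^ (?l * n)"]
      by (simp only: v(2) free_act_X4_power[OF r s rs])
    moreover have "free_act (gen_act r s \<xi>) (X4 ^ (?l * n)) v = free_act (gen_act r s \<xi>) (scal (snd \<xi> ^ n)) v"
      by (simp add: free_act_X4_power[OF r s rs] funpow_X4_ell4_mult[OF r s rs v(1)] act_scal[OF r s rs])
    ultimately show ?thesis
      using rmodule_iso_free_act[OF r s rs h v(1), of "scal (snd \<xi> ^ n)"]
      by (simp only: v(2) act_scal[OF r s rs])
  qed
  have eq: "snd \<xi> ^ n = snd \<xi>' ^ m" if "?l * n = ?l' * m" for n m
    using fun_cong[OF pow[of n], of 0] fun_cong[OF funpow_X4_ell4_mult[OF r s rs e0, of m], of 0] that
    by (simp add: bas_def)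
  \<comment> \<open>The product of the lengths gives only an equality of powers, but this shows that
    both parameters vanish or neither does. Then the lengths agree, and exponent 1 can be
    used.\<close>
  from eq[of ?l' ?l] have "snd \<xi> ^ ?l' = snd \<xi>' ^ ?l" by (simp add: mult.commute)
  then have "snd \<xi> = 0 \<longleftrightarrow> snd \<xi>' = 0" using pos by (metis power_eq_0_iff zero_power)
  then have "?l = ?l'" by (simp add: ell4_def)
  with eq[of 1 1] show ?thesis by simp
qed

lemma rmodule_iso_imp_shift:
  assumes r: "root_of_unity r" and s: "root_of_unity s" and rs: "r^2 \<noteq> s^2"
    and nz: "fst \<xi>' \<noteq> 0"
    and h: "h \<in> rmodule_iso (U_B2 r s) (Mxi r s \<xi>) (Mxi r s \<xi>')"
  obtains u where "u < ell4 r s \<xi>'" "mult_ord (r / s) dvd u" "fst \<xi> = (r * s) powi (- int u) * fst \<xi>'"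
proof -
  let ?l = "ell4 r s \<xi>" and ?l' = "ell4 r s \<xi>'"
  let ?A = "free_act (gen_act r s \<xi>)" and ?A' = "free_act (gen_act r s \<xi>')"
  have pos: "0 < ?l" by (rule l_pos[OF r s rs])
  have e0: "bas 0 \<in> carrier (Mxi r s \<xi>)" by (rule bas_carrier[OF r s rs pos])
  have zero: "(\<lambda>_. 0) \<in> carrier (Mxi r s \<xi>)" by (simp add: Mxi_def)
  define w where "w = h (bas 0)"
  have w: "w \<in> carrier (Mxi r s \<xi>')" using h e0 by (auto simp: w_def rmodule_iso_def bij_betw_def)
  have h0: "h (\<lambda>_. 0) = (\<lambda>_. 0)"
    using rmodule_iso_free_act[OF r s rs h zero, of 0] by (simp add: free_act_0)
  have inj: "inj_on h (carrier (Mxi r s \<xi>))" using h by (auto simp: rmodule_iso_def bij_betw_def)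
  have "bas 0 \<noteq> (\<lambda>_. 0)" by (auto simp: bas_def fun_eq_iff)
  then have "w \<noteq> (\<lambda>_. 0)" using inj_onD[OF inj _ e0 zero] h0 by (auto simp: w_def)
  then obtain u where wu: "w u \<noteq> 0" by auto
  with w have ul: "u < ?l'" by (auto simp: Mxi_def not_less[symmetric])
  have expand: "?A' f w = (\<lambda>b. \<Sum>a<?l'. w a * ?A' f (bas a) b)" for f
    by (subst carrier_expand[OF r s rs w])
       (simp add: act_sum_vec[OF r s rs] act_scale_vec[OF r s rs])
  have X3: "?A' (X3 r s) w = (\<lambda>b. fst \<xi> * w b)"
  proof -
    \<comment> \<open>The eigenvalue is written as the algebra element
      \<open>scal (fst \<xi>)\<close>, so that \<open>h\<close> carries the eigenvector equation
      across.\<close>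
    have "?A (X3 r s) (bas 0) = ?A (scal (fst \<xi>)) (bas 0)"
      using pos by (simp add: act_X3[OF r s rs] act_scal[OF r s rs] basX3_def)
    then show ?thesis
      using rmodule_iso_free_act[OF r s rs h e0, of "X3 r s"]
        rmodule_iso_free_act[OF r s rs h e0, of "scal (fst \<xi>)"]
      by (simp add: w_def act_scal[OF r s rs])
  qed
  have "?A' (X3 r s) w u = (r * s) powi (- int u) * fst \<xi>' * w u"
  proof -
    have "?A' (X3 r s) w u = (\<Sum>a<?l'. if a = u then (r * s) powi (- int u) * fst \<xi>' * w u else 0)"
      unfolding expand by (rule sum.cong; simp add: act_X3[OF r s rs] basX3_def; simp add: bas_def)
    then show ?thesis using ul by simp
  qed
  with X3 wu have fst_eq: "fst \<xi> = (r * s) powi (- int u) * fst \<xi>'" by simp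
  have "(r / s) ^ u = 1"
  proof (cases u)
    case (Suc m)
    have "?A (X2 r) (bas 0) = (\<lambda>_. 0)" using pos by (simp add: act_X2[OF r s rs] basX2_def)
    then have "?A' (X2 r) w m = 0"
      using fun_cong[OF rmodule_iso_free_act[OF r s rs h e0, of "X2 r"], of m] by (simp only: w_def h0)
    \<comment> \<open>Only \<open>a = u\<close> contributes to coordinate \<open>m\<close>. If
      \<open>m = 0\<close>, the index \<open>a = 0\<close> also points there because
      \<open>0 - 1 = 0\<close>, but \<open>k2\<close> vanishes at 0.\<close>
    moreover have "?A' (X2 r) w m = (\<Sum>a<?l'. if a = u then w u * Defs.k2 r s \<xi>' u else 0)"
      unfolding expand
      by (rule sum.cong; simp add: act_X2[OF r s rs] basX2[OF r s rs];
          auto simp: bas_def Suc k_zero[OF r s rs] split: nat_diff_split)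
    ultimately have "Defs.k2 r s \<xi>' u = 0" using ul wu by simp
    then show ?thesis
      using nz r0[OF r s rs] s0[OF r s rs] q1[OF r s rs] by (auto simp: Suc k2_Suc[OF r s rs])
  qed simp
  then have "mult_ord (r / s) dvd u"
    by (intro mult_ord_dvd root_of_unity_divide r s)
  with ul show ?thesis using fst_eq by (rule that)
qed

section \<open>Construction of an isomorphism\<close>

lemma funpow_X4_rmodule_iso:
  assumes r: "root_of_unity r" and s: "root_of_unity s" and rs: "r^2 \<noteq> s^2"
    and u: "u < ell4 r s \<xi>" and qu: "(r / s) ^ u = 1"
    and nz: "u = 0 \<or> snd \<xi> \<noteq> 0"
    and fst_eq: "fst \<xi> = inverse ((r * s) ^ u) * fst \<xi>'" and snd_eq: "snd \<xi> = snd \<xi>'"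
  shows "gen_act r s \<xi>' E2 ^^ u \<in> rmodule_iso (U_B2 r s) (Mxi r s \<xi>) (Mxi r s \<xi>')"
proof -
  let ?T = "gen_act r s \<xi>' E2"
  have l: "ell4 r s \<xi>' = ell4 r s \<xi>" using snd_eq by (simp add: ell4_def)
  have C: "carrier (Mxi r s \<xi>') = carrier (Mxi r s \<xi>)" by (simp add: Mxi_def l)
  have T: "gen_act r s \<xi> E2 = ?T"
    unfolding gen_act_def basX4_def[abs_def] l snd_eq gen.case by (rule refl)
  have k1: "Defs.k1 r s \<xi>' (u + a) = Defs.k1 r s \<xi> a" for a
  proof -
    have "inverse ((r * s) ^ u) * Defs.k1 r s \<xi>' a = Defs.k1 r s \<xi> a"
      unfolding k1_def[OF r s rs] fst_eq by (simp only: mult_ac)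
    then show ?thesis by (simp only: k1_shift[OF r s rs qu])
  qed
  note lin = funpow_X4_add[OF r s rs] funpow_X4_scale[OF r s rs] op_add[OF r s rs] op_scale[OF r s rs]
  have X1: "(?T ^^ u) (gen_act r s \<xi> E1 v) = gen_act r s \<xi>' E1 ((?T ^^ u) v)"
    if v: "v \<in> carrier (Mxi r s \<xi>)" for v
  proof (rule linear_eqI[OF r s rs _ _ _ _ _ v])
    fix a assume a: "a < ell4 r s \<xi>"
    \<comment> \<open>Powers of \<open>?T\<close> applied to \<open>bas 0\<close> avoid a case split
      on whether \<open>u + a\<close> passes the end of the basis.\<close>
    have "gen_act r s \<xi>' E1 ((?T ^^ u) (bas a)) = gen_act r s \<xi>' E1 ((?T ^^ (u + a)) (bas 0))"
      using funpow_X4_bas[OF r s rs, of a \<xi>'] a l by (simp add: funpow_add)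
    also have "\<dots> = (\<lambda>b. Defs.k1 r s \<xi> a * (?T ^^ (u + a - 2)) (bas 0) b)"
      using X1_funpow_X4[OF r s rs, of "u + a" \<xi>'] a nz l snd_eq by (auto simp: k1)
    also have "\<dots> = (\<lambda>b. Defs.k1 r s \<xi> a * (?T ^^ u) (bas (a - 2)) b)"
    proof (cases "a < 2")
      case True
      then have "Defs.k1 r s \<xi> a = 0" by (auto simp: less_2_cases_iff k_zero[OF r s rs])
      then show ?thesis by simp
    next
      case False
      then have "u + a - 2 = u + (a - 2)" by simp
      then have "(?T ^^ (u + a - 2)) (bas 0) = (?T ^^ u) ((?T ^^ (a - 2)) (bas 0))"
        by (simp only: funpow_add comp_apply)
      then show ?thesis
        using funpow_X4_bas[OF r s rs, of "a - 2" \<xi>'] a l by simp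
    qed
    also have "\<dots> = (?T ^^ u) (gen_act r s \<xi> E1 (bas a))"
      using a by (simp add: op1[OF r s rs] lin)
    finally show "(?T ^^ u) (gen_act r s \<xi> E1 (bas a)) = gen_act r s \<xi>' E1 ((?T ^^ u) (bas a))" ..
  qed (simp_all add: lin)
  have gen: "(?T ^^ u) (gen_act r s \<xi> g v) = gen_act r s \<xi>' g ((?T ^^ u) v)"
    if "v \<in> carrier (Mxi r s \<xi>)" for g v
    using X1[OF that] by (cases g) (simp_all add: T funpow_swap1)
  have act: "(?T ^^ u) (free_act (gen_act r s \<xi>) f v) = free_act (gen_act r s \<xi>') f ((?T ^^ u) v)"
    if "v \<in> carrier (Mxi r s \<xi>)" for f v
    using lin(1,2) gen_act_closed[OF r s rs] gen that by (rule free_act_intertwine)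
  have closed: "(?T ^^ n) v \<in> carrier (Mxi r s \<xi>)" if "v \<in> carrier (Mxi r s \<xi>)" for n v
    using funpow_X4_closed[OF r s rs, of v \<xi>' n] that by (simp add: C)
  have bij: "bij_betw (?T ^^ u) (carrier (Mxi r s \<xi>)) (carrier (Mxi r s \<xi>'))"
  proof (cases "u = 0")
    case True
    then show ?thesis by (simp add: C bij_betw_def)
  next
    case False
    with nz have nz: "snd \<xi>' \<noteq> 0" by (simp add: snd_eq)
    \<comment> \<open>Completing \<open>u\<close> steps to a full cycle gives the scalar
      \<open>snd \<xi>'\<close>, which is then divided out.\<close>
    define g where "g v = (\<lambda>b. inverse (snd \<xi>') * (?T ^^ (ell4 r s \<xi> - u)) v b)" for v
    have full: "(?T ^^ ell4 r s \<xi>) v = (\<lambda>b. snd \<xi>' * v b)" if "v \<in> carrier (Mxi r s \<xi>)" for v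
      using funpow_X4_ell4[OF r s rs, of v \<xi>'] that by (simp add: C l)
    have split: "(?T ^^ (ell4 r s \<xi> - u)) ((?T ^^ u) v) = (?T ^^ ell4 r s \<xi>) v"
      "(?T ^^ u) ((?T ^^ (ell4 r s \<xi> - u)) v) = (?T ^^ ell4 r s \<xi>) v" for v
      using u by (simp_all flip: funpow_add[THEN fun_cong, unfolded comp_apply])
    show ?thesis
    proof (rule bij_betw_byWitness[where f' = g])
      show "\<forall>v\<in>carrier (Mxi r s \<xi>). g ((?T ^^ u) v) = v"
        using nz by (simp add: g_def split full mult.assoc[symmetric])
      show "\<forall>v\<in>carrier (Mxi r s \<xi>'). (?T ^^ u) (g v) = v"
        using nz by (simp add: g_def lin split full C mult.assoc[symmetric])
      show "(?T ^^ u) ` carrier (Mxi r s \<xi>) \<subseteq> carrier (Mxi r s \<xi>')"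
        using closed C by auto
      show "g ` carrier (Mxi r s \<xi>') \<subseteq> carrier (Mxi r s \<xi>)"
        using closed[of _ "ell4 r s \<xi> - u"] by (auto simp: C g_def) (auto simp: Mxi_def)
    qed
  qed
  show ?thesis
    unfolding rmodule_iso_def mem_Collect_eq
  proof (intro conjI ballI bij)
    fix x y
    show "(?T ^^ u) (x \<oplus>\<^bsub>Mxi r s \<xi>\<^esub> y) = (?T ^^ u) x \<oplus>\<^bsub>Mxi r s \<xi>'\<^esub> (?T ^^ u) y"
      by (simp add: Mxi_def lin)
  next
    fix x A assume x: "x \<in> carrier (Mxi r s \<xi>)" and "A \<in> carrier (U_B2 r s)"
    then obtain f where "A = U_class r s f" by (auto elim: U_carrierE[OF r s rs])
    then show "(?T ^^ u) (ract (Mxi r s \<xi>) x A) = ract (Mxi r s \<xi>') ((?T ^^ u) x) A"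
      using x closed[OF x, of u] by (simp add: Mxi_ract[OF r s rs] C act)
  qed
qed

theorem theorem10p5:
  fixes r s :: complex and \<xi> \<xi>' :: "complex \<times> complex"
  assumes "root_of_unity r" and "root_of_unity s" and "r^2 \<noteq> s^2"
    and "\<xi> \<in> (UNIV - {0}) \<times> UNIV" and "\<xi>' \<in> (UNIV - {0}) \<times> UNIV"
  shows "rmodule_isomorphic (U_B2 r s) (Mxi r s \<xi>) (Mxi r s \<xi>') \<longleftrightarrow>
    (\<exists>u::nat. 0 \<le> u \<and> u \<le> ell4 r s \<xi> - 1 \<and> mult_ord (r / s) dvd u \<and>
       fst \<xi> = (r * s) powi (- int u) * fst \<xi>' \<and> snd \<xi> = snd \<xi>')"
proof
  note params = assms(1-3)
  assume "rmodule_isomorphic (U_B2 r s) (Mxi r s \<xi>) (Mxi r s \<xi>')"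
  then obtain h where h: "h \<in> rmodule_iso (U_B2 r s) (Mxi r s \<xi>) (Mxi r s \<xi>')"
    by (auto simp: rmodule_isomorphic_def)
  have snd_eq: "snd \<xi> = snd \<xi>'" by (rule rmodule_iso_snd_eq[OF params h])
  have "fst \<xi>' \<noteq> 0" using assms(5) by auto
  from rmodule_iso_imp_shift[OF params this h]
  obtain u where u: "u < ell4 r s \<xi>'" "mult_ord (r / s) dvd u"
    "fst \<xi> = (r * s) powi (- int u) * fst \<xi>'" .
  moreover have "ell4 r s \<xi> = ell4 r s \<xi>'" by (simp add: ell4_def snd_eq)
  ultimately show "\<exists>u::nat. 0 \<le> u \<and> u \<le> ell4 r s \<xi> - 1 \<and> mult_ord (r / s) dvd u \<and>
       fst \<xi> = (r * s) powi (- int u) * fst \<xi>' \<and> snd \<xi> = snd \<xi>'"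
    using snd_eq by (intro exI[of _ u]) auto
next
  note params = assms(1-3)
  assume "\<exists>u::nat. 0 \<le> u \<and> u \<le> ell4 r s \<xi> - 1 \<and> mult_ord (r / s) dvd u \<and>
       fst \<xi> = (r * s) powi (- int u) * fst \<xi>' \<and> snd \<xi> = snd \<xi>'"
  then obtain u where u: "u \<le> ell4 r s \<xi> - 1" "mult_ord (r / s) dvd u"
    "fst \<xi> = (r * s) powi (- int u) * fst \<xi>'" "snd \<xi> = snd \<xi>'" by blast
  have ul: "u < ell4 r s \<xi>" using u(1) l_pos[OF params, of \<xi>] by linarith
  \<comment> \<open>If \<open>snd \<xi> = 0\<close>, then \<open>ell4\<close> is the order of
    \<open>r / s\<close>, whose only multiple below itself is 0.\<close>
  have "u = 0 \<or> snd \<xi> \<noteq> 0"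
    using ul u(2) by (auto simp: ell4_def dest: dvd_imp_le split: if_splits)
  moreover have "fst \<xi> = inverse ((r * s) ^ u) * fst \<xi>'"
    using u(3) by (simp add: power_int_minus)
  ultimately show "rmodule_isomorphic (U_B2 r s) (Mxi r s \<xi>) (Mxi r s \<xi>')"
    using funpow_X4_rmodule_iso[OF params ul power_mult_ord_dvd[OF u(2)] _ _ u(4)]
    unfolding rmodule_isomorphic_def by blast
qed

end
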